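(* Let $\$$ be a real-linear involution of $W$ that is either complex-linear or anti-linear. Suppose a commutative formal field theory $\mathcal D\subset\mathcal K$ is invariant under $\sigma(L_+^\uparrow)$. Then $\mathcal D$ is invariant under $C_\$\circ\sigma'(g)$ for all $g\in L_+^\downarrow$ if and only if $\mathcal D$ is $\$$-Hermitian.
   Context: Setting: $M$ real of dimension $d\ge3$ with Lorentzian $\eta$; $L_+^\uparrow$ the identity component of the Lorentz group, $L_+^\downarrow$ the determinant-one time-orientation-reversing component, $L_+=L_+^\uparrow\cup L_+^\downarrow$. $L_+(\mathbb C)$ (complex determinant-one isometries of $M^{\mathbb C}$) is identified with the complexification of $L_+^\uparrow$ and contains $L_+$. $\rho$ is a finite-dimensional real representation of $L_+^\uparrow$ on $V$; $\rho'$ is the representation of $L_+$ on $V$ obtained by restricting the holomorphic extension $\rho^{\mathbb C}$ of $\rho$ to $L_+(\mathbb C)$ (it preserves $V$ on $L_+$); $\omega,\omega'$ likewise for a representation $\omega$ of $L_+^\uparrow$ on $M$. $W=\mathrm{Hom}_{\mathbb R}(V,\mathbb C)$; $\mathcal K=\mathcal F(W\otimes_{\mathbb R}TM)$ is the free non-commutative complex algebra on field symbols $\underline\Phi^\lambda_{\xi_1\cdots\xi_n}=\lambda\otimes(\xi_1\otimes\cdots\otimes\xi_n)$. The classical action induced by $\rho,\omega$ acts by complex-linear algebra automorphisms with $\sigma(g)\underline\Phi^\lambda_{\xi_1\cdots\xi_n}=\underline\Phi^{\lambda\circ\rho(g^{-1})}_{\omega(g)\xi_1\cdots\omega(g)\xi_n}$;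 $\sigma$ is that of $L_+^\uparrow$, $\sigma'$ that of $L_+$ induced by $\rho',\omega'$. A commutative formal field theory is $\mathcal D=c^{-1}(\mathcal D_c)$ with $c\colon\mathcal K\to\mathcal F_c(W\otimes_{\mathbb R}TM)$ the quotient to the free commutative complex algebra and $\mathcal D_c$ a complex affine subspace. $S$ is the complex-linear anti-automorphism of $\mathcal K$ fixing field symbols. $C_\$$ is the unique algebra automorphism of $\mathcal K$ (complex-linear or anti-linear as $\$$ is) with $C_\$(\underline\Phi^\lambda_{\xi_1\cdots\xi_n})=\underline\Phi^{\$(\lambda)}_{\xi_1\cdots\xi_n}$; $\dagger_\$=S\circ C_\$$. $\mathcal D$ is $\$$-Hermitian if $\dagger_\$(\mathcal D)\subseteq\mathcal D$. Invariance means mapping $\mathcal D$ into $\mathcal D$. *)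

theory Defs
  imports "HOL-Analysis.Analysis" "HOL-Library.Multiset"
begin

(* Coordinates: M = real^'n with Minkowski form diag(-1,1,...,1) (time index t0);
   V = real^'k; W = Hom_R(V,C) identified with complex^'k via lambda |-> (lambda(e_a))_a.
   A field symbol basis element Phi^{e*_a}_{e_i1 ... e_in} is the pair (a, [i1,...,in]). *)

type_synonym ('k,'n) gen = "'k \<times> 'n list"
type_synonym ('k,'n) kel = "('k,'n) gen list \<Rightarrow> complex"

definition minkowski :: "'n::finite \<Rightarrow> real^'n^'n" where
  "minkowski t0 = (\<chi> i. \<chi> j. if i = j then (if i = t0 then -1 else 1) else 0)"

definition lorentz_plus :: "'n::finite \<Rightarrow> (real^'n^'n) set" where
  "lorentz_plus t0 = {A. transpose A ** minkowski t0 ** A = minkowski t0 \<and> det A = 1}"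

definition lorentz_up :: "'n::finite \<Rightarrow> (real^'n^'n) set" where
  "lorentz_up t0 = {A \<in> lorentz_plus t0. A $ t0 $ t0 > 0}"

definition lorentz_down :: "'n::finite \<Rightarrow> (real^'n^'n) set" where
  "lorentz_down t0 = {A \<in> lorentz_plus t0. A $ t0 $ t0 < 0}"

definition cmat :: "real^'a::finite^'b::finite \<Rightarrow> complex^'a^'b" where
  "cmat A = (\<chi> i. \<chi> j. complex_of_real (A $ i $ j))"

definition lorentz_plus_C :: "'n::finite \<Rightarrow> (complex^'n^'n) set" where
  "lorentz_plus_C t0 = {A. transpose A ** cmat (minkowski t0) ** A = cmat (minkowski t0) \<and> det A = 1}"

definition cscale :: "complex \<Rightarrow> complex^'a::finite^'b::finite \<Rightarrow> complex^'a^'b" where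
  "cscale c A = (\<chi> i. \<chi> j. c * A $ i $ j)"

definition holomorphic_on_set ::
  "(complex^'n::finite^'n) set \<Rightarrow> (complex^'n^'n \<Rightarrow> complex^'k::finite^'k) \<Rightarrow> bool" where
  "holomorphic_on_set S F \<longleftrightarrow> (\<forall>A\<in>S. \<exists>U G G'. open U \<and> A \<in> U \<and> (\<forall>B\<in>U \<inter> S. G B = F B) \<and>
     (\<forall>B\<in>U. (G has_derivative G' B) (at B) \<and> (\<forall>c X. G' B (cscale c X) = cscale c (G' B X))))"

definition is_rep :: "'n::finite \<Rightarrow> (real^'n^'n \<Rightarrow> real^'k::finite^'k) \<Rightarrow> bool" where
  "is_rep t0 \<rho> \<longleftrightarrow> \<rho> (mat 1) = mat 1 \<and>
     (\<forall>g\<in>lorentz_up t0. \<forall>h\<in>lorentz_up t0. \<rho> (g ** h) = \<rho> g ** \<rho> h)"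

definition holo_ext :: "'n::finite \<Rightarrow> (real^'n^'n \<Rightarrow> real^'k::finite^'k)
    \<Rightarrow> (complex^'n^'n \<Rightarrow> complex^'k^'k) \<Rightarrow> bool" where
  "holo_ext t0 \<rho> \<rho>C \<longleftrightarrow> holomorphic_on_set (lorentz_plus_C t0) \<rho>C \<and> \<rho>C (mat 1) = mat 1 \<and>
     (\<forall>A\<in>lorentz_plus_C t0. \<forall>B\<in>lorentz_plus_C t0. \<rho>C (A ** B) = \<rho>C A ** \<rho>C B) \<and>
     (\<forall>g\<in>lorentz_up t0. \<rho>C (cmat g) = cmat (\<rho> g))"

text \<open>Elements: complex coefficient functions on words of basis field symbols
  (finite support required for membership in K).\<close>

definition kset :: "('k,'n) kel set" where
  "kset = {p. finite {w. p w \<noteq> 0}}"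

definition kone :: "('k,'n) kel" where
  "kone w = (if w = [] then 1 else 0)"

definition kmult :: "('k,'n) kel \<Rightarrow> ('k,'n) kel \<Rightarrow> ('k,'n) kel" where
  "kmult p q w = (\<Sum>i\<le>length w. p (take i w) * q (drop i w))"

definition word_img :: "(('k,'n) gen \<Rightarrow> ('k,'n) kel) \<Rightarrow> ('k,'n) gen list \<Rightarrow> ('k,'n) kel" where
  "word_img f w = foldr (\<lambda>x acc. kmult (f x) acc) w kone"

definition ext_lin :: "(('k,'n) gen \<Rightarrow> ('k,'n) kel) \<Rightarrow> ('k,'n) kel \<Rightarrow> ('k,'n) kel" where
  "ext_lin f p = (\<lambda>v. \<Sum>w\<in>{w. p w \<noteq> 0}. p w * word_img f w v)"

definition ext_anti :: "(('k,'n) gen \<Rightarrow> ('k,'n) kel) \<Rightarrow> ('k,'n) kel \<Rightarrow> ('k,'n) kel" where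
  "ext_anti f p = (\<lambda>v. \<Sum>w\<in>{w. p w \<noteq> 0}. cnj (p w) * word_img f w v)"

text \<open>Image of the generator Phi^{e*_a}_{e_is}: Phi^{e*_a o R}_{Om e_i1 ... Om e_in}.\<close>
definition gen_act :: "complex^'k::finite^'k \<Rightarrow> complex^'n::finite^'n \<Rightarrow> ('k,'n) gen \<Rightarrow> ('k,'n) kel" where
  "gen_act R Om x = (case x of (a, is) \<Rightarrow> (\<lambda>w. case w of
      [(b, js)] \<Rightarrow> (if length js = length is
                     then R $ a $ b * (\<Prod>m<length is. Om $ (js ! m) $ (is ! m)) else 0)
    | _ \<Rightarrow> 0))"

definition sigma_cl :: "(real^'n::finite^'n \<Rightarrow> real^'k::finite^'k) \<Rightarrow> (real^'n^'n \<Rightarrow> real^'n^'n)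
    \<Rightarrow> real^'n^'n \<Rightarrow> ('k,'n) kel \<Rightarrow> ('k,'n) kel" where
  "sigma_cl \<rho> \<omega> g = ext_lin (gen_act (cmat (\<rho> (matrix_inv g))) (cmat (\<omega> g)))"

definition sigma' :: "(complex^'n::finite^'n \<Rightarrow> complex^'k::finite^'k) \<Rightarrow> (complex^'n^'n \<Rightarrow> complex^'n^'n)
    \<Rightarrow> real^'n^'n \<Rightarrow> ('k,'n) kel \<Rightarrow> ('k,'n) kel" where
  "sigma' \<rho>C \<omega>C g = ext_lin (gen_act (\<rho>C (cmat (matrix_inv g))) (\<omega>C (cmat g)))"

definition complex_lin :: "(complex^'k::finite \<Rightarrow> complex^'k) \<Rightarrow> bool" where
  "complex_lin d \<longleftrightarrow> (\<forall>c x. d (c *s x) = c *s d x)"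

definition anti_lin :: "(complex^'k::finite \<Rightarrow> complex^'k) \<Rightarrow> bool" where
  "anti_lin d \<longleftrightarrow> (\<forall>c x. d (c *s x) = cnj c *s d x)"

definition dollar_inv :: "(complex^'k::finite \<Rightarrow> complex^'k) \<Rightarrow> bool" where
  "dollar_inv d \<longleftrightarrow> linear d \<and> (\<forall>x. d (d x) = x) \<and> (complex_lin d \<or> anti_lin d)"

definition gen_C :: "(complex^'k::finite \<Rightarrow> complex^'k) \<Rightarrow> ('k,'n) gen \<Rightarrow> ('k,'n) kel" where
  "gen_C d x = (case x of (a, is) \<Rightarrow> (\<lambda>w. case w of
      [(b, js)] \<Rightarrow> (if js = is then d (axis a 1) $ b else 0)
    | _ \<Rightarrow> 0))"

definition C_dol :: "(complex^'k::finite \<Rightarrow> complex^'k) \<Rightarrow> ('k,'n) kel \<Rightarrow> ('k,'n) kel" where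
  "C_dol d = (if complex_lin d then ext_lin (gen_C d) else ext_anti (gen_C d))"

text \<open>S: complex-linear anti-automorphism fixing field symbols (reverses words).\<close>
definition S_rev :: "('k,'n) kel \<Rightarrow> ('k,'n) kel" where
  "S_rev p = (\<lambda>w. p (rev w))"

definition dagger :: "(complex^'k::finite \<Rightarrow> complex^'k) \<Rightarrow> ('k,'n) kel \<Rightarrow> ('k,'n) kel" where
  "dagger d = S_rev \<circ> C_dol d"

text \<open>Quotient map c onto the free commutative algebra (functions on multisets of symbols).\<close>
definition comm :: "('k,'n) kel \<Rightarrow> (('k,'n) gen multiset \<Rightarrow> complex)" where
  "comm p = (\<lambda>m. \<Sum>w\<in>{w. p w \<noteq> 0 \<and> mset w = m}. p w)"

definition comm_affine :: "(('k,'n) gen multiset \<Rightarrow> complex) set \<Rightarrow> bool" where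
  "comm_affine Dc \<longleftrightarrow> Dc \<noteq> {} \<and> Dc \<subseteq> {q. finite {m. q m \<noteq> 0}} \<and>
     (\<forall>x\<in>Dc. \<forall>y\<in>Dc. \<forall>t::complex. (\<lambda>m. (1 - t) * x m + t * y m) \<in> Dc)"

definition comm_fft :: "(('k,'n) gen multiset \<Rightarrow> complex) set \<Rightarrow> ('k,'n) kel set" where
  "comm_fft Dc = {p \<in> kset. comm p \<in> Dc}"

end

theory Submission
  imports Defs "HOL-Complex_Analysis.Conformal_Mappings" "HOL-Library.Function_Algebras"
begin

text \<open>The boost of rapidity \<open>z\<close> in a fixed time-like plane is an entire curve in the complex Lorentz
  group. For real \<open>z\<close> it lies in the orthochronous component, and at \<open>z = \<i>\<pi>\<close> it is the
  time-reversing element \<open>diag(-1,-1,1,...,1)\<close>. Acting with the holomorphic extensions on a fixed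
  element of the algebra gives an entire curve in a finite-dimensional space, so by the identity
  theorem it stays in a complex affine subspace as soon as it does so for real \<open>z\<close>. Hence
  invariance under the orthochronous component extends to the other one. In the same way, invariance
  under $ combined with the time-reversing transformations can be continued from rapidities
  \<open>\<i>\<pi> + x\<close> to the identity and gives invariance under \<open>C_dol\<close>. Finally, word reversal is invisible
  in the commutative quotient, so this is the same as invariance under \<open>dagger\<close>.\<close>

subsection \<open>The complex Lorentz group\<close>

lemma cmat_nth [simp]: "cmat A $ i $ j = complex_of_real (A $ i $ j)"
  by (simp add: cmat_def)

lemma cmat_mult: "cmat (A ** B) = cmat A ** cmat B"
  by (simp add: vec_eq_iff matrix_matrix_mult_def)

lemma cmat_transpose: "cmat (transpose A) = transpose (cmat A)"
  by (simp add: vec_eq_iff transpose_def)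

lemma cmat_mat_1 [simp]: "cmat (mat 1) = mat 1"
  by (simp add: vec_eq_iff mat_def)

lemma cmat_eq_iff [simp]: "cmat A = cmat B \<longleftrightarrow> A = B"
  by (simp add: vec_eq_iff)

lemma det_cmat: "det (cmat A) = complex_of_real (det A)"
  by (simp add: det_def)

lemma cmat_in_lorentz_plus_C_iff:
  "cmat A \<in> lorentz_plus_C t0 \<longleftrightarrow> A \<in> lorentz_plus t0"
proof -
  have "transpose (cmat A) ** cmat (minkowski t0) ** cmat A = cmat (transpose A ** minkowski t0 ** A)"
    by (simp add: cmat_mult cmat_transpose)
  then show ?thesis
    by (auto simp: lorentz_plus_C_def lorentz_plus_def det_cmat)
qed

lemma minkowski_mult_nth:
  "(cmat (minkowski t0) ** N) $ i $ j = (if i = t0 then - N $ i $ j else N $ i $ j)"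
proof -
  have "(cmat (minkowski t0) ** N) $ i $ j
      = (\<Sum>k\<in>UNIV. if k = i then (if i = t0 then - N $ i $ j else N $ i $ j) else 0)"
    unfolding matrix_matrix_mult_def vec_lambda_beta by (rule sum.cong) (auto simp: minkowski_def)
  then show ?thesis by simp
qed

lemma mult_minkowski_nth:
  "(N ** cmat (minkowski t0)) $ i $ j = (if j = t0 then - N $ i $ j else N $ i $ j)"
proof -
  have "(N ** cmat (minkowski t0)) $ i $ j
      = (\<Sum>k\<in>UNIV. if k = j then (if j = t0 then - N $ i $ j else N $ i $ j) else 0)"
    unfolding matrix_matrix_mult_def vec_lambda_beta by (rule sum.cong) (auto simp: minkowski_def)
  then show ?thesis by simp
qed

lemma minkowski_sq: "cmat (minkowski t0) ** cmat (minkowski t0) = mat 1"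
  by (simp add: vec_eq_iff minkowski_mult_nth) (simp add: minkowski_def mat_def)

lemma minkowski_transpose: "transpose (cmat (minkowski t0)) = cmat (minkowski t0)"
  by (auto simp: vec_eq_iff minkowski_def transpose_def)

lemma lorentz_plus_C_mult:
  assumes "A \<in> lorentz_plus_C t0" "B \<in> lorentz_plus_C t0"
  shows "A ** B \<in> lorentz_plus_C t0"
proof -
  let ?e = "cmat (minkowski t0)"
  have "transpose (A ** B) ** ?e ** (A ** B) = transpose B ** (transpose A ** ?e ** A) ** B"
    by (simp add: matrix_transpose_mul matrix_mul_assoc)
  also have "\<dots> = ?e"
    using assms by (simp add: lorentz_plus_C_def)
  finally show ?thesis
    using assms by (simp add: lorentz_plus_C_def det_mul)
qed

text \<open>On \<open>lorentz_plus_C t0\<close> this is the inverse, written linearly in the entries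
  of \<open>A\<close>, so it stays entire along an entire curve.\<close>

definition lorentz_inv :: "'n::finite \<Rightarrow> complex^'n^'n \<Rightarrow> complex^'n^'n" where
  "lorentz_inv t0 A = cmat (minkowski t0) ** transpose A ** cmat (minkowski t0)"

lemma lorentz_inv_nth:
  "lorentz_inv t0 A $ i $ j = (if i = t0 then -1 else 1) * (if j = t0 then -1 else 1) * A $ j $ i"
  by (simp add: lorentz_inv_def mult_minkowski_nth minkowski_mult_nth) (simp add: transpose_def)

lemma lorentz_inv_left:
  assumes "A \<in> lorentz_plus_C t0"
  shows "lorentz_inv t0 A ** A = mat 1"
proof -
  let ?e = "cmat (minkowski t0)"
  have "lorentz_inv t0 A ** A = ?e ** (transpose A ** ?e ** A)"
    by (simp add: lorentz_inv_def matrix_mul_assoc)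
  also have "\<dots> = mat 1"
    using assms by (simp add: lorentz_plus_C_def minkowski_sq)
  finally show ?thesis .
qed

lemma lorentz_inv_right:
  assumes "A \<in> lorentz_plus_C t0"
  shows "A ** lorentz_inv t0 A = mat 1"
  using lorentz_inv_left[OF assms] matrix_left_right_inverse by blast

lemma lorentz_inv_in_lorentz_plus_C:
  assumes "A \<in> lorentz_plus_C t0"
  shows "lorentz_inv t0 A \<in> lorentz_plus_C t0"
proof -
  let ?e = "cmat (minkowski t0)"
  have "transpose (lorentz_inv t0 A) ** ?e ** lorentz_inv t0 A
      = ?e ** A ** (?e ** ?e) ** lorentz_inv t0 A"
    by (simp add: lorentz_inv_def matrix_transpose_mul minkowski_transpose matrix_mul_assoc)
  also have "\<dots> = ?e ** (A ** lorentz_inv t0 A)"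
    by (simp add: minkowski_sq matrix_mul_assoc)
  also have "\<dots> = ?e"
    using lorentz_inv_right[OF assms] by simp
  finally have 1: "transpose (lorentz_inv t0 A) ** ?e ** lorentz_inv t0 A = ?e" .
  have "det (lorentz_inv t0 A) * det A = 1"
    using arg_cong[OF lorentz_inv_left[OF assms], of det] by (simp add: det_mul)
  with 1 assms show ?thesis
    by (simp add: lorentz_plus_C_def)
qed

text \<open>Both sides invert \<open>cmat g\<close>. This lets the real inverse occurring in
  \<open>sigma'\<close> be continued to complex matrices.\<close>

lemma cmat_matrix_inv:
  assumes "g \<in> lorentz_plus t0"
  shows "cmat (matrix_inv g) = lorentz_inv t0 (cmat g)"
proof -
  have g: "cmat g \<in> lorentz_plus_C t0"
    using assms by (simp add: cmat_in_lorentz_plus_C_iff)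
  have "det g \<noteq> 0"
    using assms by (simp add: lorentz_plus_def)
  then have "g ** matrix_inv g = mat 1"
    unfolding matrix_inv_def invertible_det_nz[symmetric] invertible_def by (rule someI2_ex) simp
  then have "cmat g ** cmat (matrix_inv g) = mat 1"
    by (metis cmat_mat_1 cmat_mult)
  then have "lorentz_inv t0 (cmat g) ** (cmat g ** cmat (matrix_inv g)) = lorentz_inv t0 (cmat g)"
    by simp
  then show ?thesis
    by (simp add: matrix_mul_assoc lorentz_inv_left[OF g])
qed

text \<open>In the time-time entry the two signs in \<open>lorentz_inv\<close> cancel, so that entry
  is the same for \<open>g\<close> and its inverse.\<close>

lemma matrix_inv_in_lorentz_up:
  assumes "g \<in> lorentz_up t0"
  shows "matrix_inv g \<in> lorentz_up t0"
proof -
  have g: "g \<in> lorentz_plus t0" "g $ t0 $ t0 > 0"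
    using assms by (auto simp: lorentz_up_def)
  have "cmat (matrix_inv g) $ t0 $ t0 = cmat g $ t0 $ t0"
    unfolding cmat_matrix_inv[OF g(1)] by (simp add: lorentz_inv_nth)
  then have "matrix_inv g $ t0 $ t0 = g $ t0 $ t0"
    by simp
  moreover have "matrix_inv g \<in> lorentz_plus t0"
    using g(1) by (metis cmat_in_lorentz_plus_C_iff cmat_matrix_inv lorentz_inv_in_lorentz_plus_C)
  ultimately show ?thesis
    using g(2) by (simp add: lorentz_up_def)
qed

subsection \<open>Boosts\<close>

text \<open>Stated over any commutative ring, so that real boosts, complex boosts and the reflection
  (\<open>a = -1\<close>, \<open>b = 0\<close>) share one calculus.\<close>

definition hblock :: "'n::finite \<Rightarrow> 'n \<Rightarrow> 'a::comm_ring_1 \<Rightarrow> 'a \<Rightarrow> 'a^'n^'n" where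
  "hblock s t a b = (\<chi> i j. if i = j then (if i = s \<or> i = t then a else 1)
     else if i = s \<and> j = t \<or> i = t \<and> j = s then b else 0)"

lemma hblock_mult_nth:
  fixes a b :: "'a::comm_ring_1" and N :: "'a^'m::finite^'n::finite"
  assumes "s \<noteq> t"
  shows "(hblock s t a b ** N) $ i $ j =
    (if i = s then a * N $ s $ j + b * N $ t $ j
     else if i = t then b * N $ s $ j + a * N $ t $ j else N $ i $ j)"
proof -
  \<comment> \<open>Row \<open>i\<close> of the block lives in columns \<open>s\<close>,
    \<open>t\<close> and \<open>i\<close>. For \<open>i\<close> in the plane \<open>r\<close>
    vanishes, because \<open>p\<close> or \<open>q\<close> already counts the diagonal
    entry.\<close>
  define p where "p = (if i = s then a else if i = t then b else 0)"
  define q where "q = (if i = s then b else if i = t then a else 0)"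
  define r where "r = (if i = s \<or> i = t then 0 else 1 :: 'a)"
  have "(hblock s t a b ** N) $ i $ j
      = (\<Sum>k\<in>UNIV. (if k = s then p * N $ s $ j else 0) + (if k = t then q * N $ t $ j else 0)
           + (if k = i then r * N $ i $ j else 0))"
    unfolding matrix_matrix_mult_def vec_lambda_beta
    by (rule sum.cong) (use assms in \<open>auto simp: hblock_def p_def q_def r_def\<close>)
  also have "\<dots> = p * N $ s $ j + q * N $ t $ j + r * N $ i $ j"
    by (simp add: sum.distrib)
  finally show ?thesis
    using assms by (simp add: p_def q_def r_def)
qed

text \<open>The plane blocks multiply like split-complex numbers \<open>a + b * j\<close> with
  \<open>j * j = 1\<close>.\<close>

lemma hblock_mult:
  assumes "s \<noteq> t"
  shows "hblock s t a b ** hblock s t c e = hblock s t (a * c + b * e) (a * e + b * c)"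
  using assms
  by (simp add: vec_eq_iff hblock_mult_nth) (simp add: hblock_def algebra_simps)

lemma hblock_1_0 [simp]: "hblock s t 1 0 = mat 1"
  by (simp add: vec_eq_iff hblock_def mat_def)

lemma cmat_hblock: "cmat (hblock s t a b) = hblock s t (complex_of_real a) (complex_of_real b)"
  by (simp add: vec_eq_iff hblock_def)

lemma transpose_hblock: "transpose (hblock s t a b) = hblock s t a b"
  by (auto simp: vec_eq_iff hblock_def transpose_def)

text \<open>Halving the rapidity exhibits a boost as a square, so its determinant is 1.\<close>

lemma hblock_cosh_sinh_in_lorentz_plus_C:
  fixes z :: complex and s t :: "'n::finite"
  assumes "s \<noteq> t"
  shows "hblock s t (cosh z) (sinh z) \<in> lorentz_plus_C s"
proof -
  let ?B = "\<lambda>z. hblock s t (cosh z) (sinh z) :: complex^'n^'n"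
  let ?e = "cmat (minkowski s)"
  have 1: "cosh w * cosh w - sinh w * sinh w = 1" for w :: complex
    using hyperbolic_pythagoras[of w] by (simp add: power2_eq_square)
  have form: "transpose (?B w) ** ?e ** ?B w = ?e" for w
    unfolding transpose_hblock matrix_mul_assoc[symmetric]
    using assms 1[of w]
    by (simp add: vec_eq_iff hblock_mult_nth minkowski_mult_nth)
       (auto simp: hblock_def minkowski_def algebra_simps)
  \<comment> \<open>Invariance of the form fixes the determinant only up to sign.\<close>
  have "det (?B w) * det (?B w) = 1" for w
  proof -
    have "det ?e * det ?e = 1"
      using arg_cong[OF minkowski_sq[of s], of det] by (simp add: det_mul)
    then have "det ?e \<noteq> 0" by auto
    moreover have "det (?B w) * det ?e * det (?B w) = det ?e"
      using arg_cong[OF form[of w], of det] by (simp add: det_mul)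
    ultimately show ?thesis by (simp add: field_simps)
  qed
  moreover have "?B z = ?B (z/2) ** ?B (z/2)"
    using assms cosh_add[of "z/2" "z/2"] sinh_add[of "z/2" "z/2"]
    by (simp add: hblock_mult algebra_simps)
  ultimately have "det (?B z) = 1"
    by (simp add: det_mul)
  with form show ?thesis
    by (simp add: lorentz_plus_C_def)
qed

text \<open>Shifting the rapidity by \<open>\<i> * pi\<close> negates the plane block of a boost.
  This is how a complex curve joins the two real components.\<close>

lemma cosh_i_pi_add: "cosh (\<i> * of_real pi + z) = - cosh z"
  and sinh_i_pi_add: "sinh (\<i> * of_real pi + z) = - sinh z" for z :: complex
proof -
  have e: "exp (\<i> * of_real pi) = (-1::complex)" "exp (- (\<i> * of_real pi)) = (-1::complex)"
    by (simp_all add: exp_minus)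
  have c: "cosh (\<i> * of_real pi) = (-1::complex)" "sinh (\<i> * of_real pi) = (0::complex)"
    by (simp_all add: cosh_field_def sinh_field_def e)
  show "cosh (\<i> * of_real pi + z) = - cosh z" "sinh (\<i> * of_real pi + z) = - sinh z"
    by (simp_all add: cosh_add sinh_add c)
qed

lemma cosh_complex_of_real: "cosh (complex_of_real x) = complex_of_real (cosh x)"
  and sinh_complex_of_real: "sinh (complex_of_real x) = complex_of_real (sinh x)"
  by (simp_all add: cosh_field_def sinh_field_def flip: exp_of_real)

text \<open>Both families are real points of the complex boost curve, at rapidities \<open>x\<close>
  and \<open>\<i> * pi + x\<close>.\<close>

lemma boost_in_lorentz_plus:
  assumes "s \<noteq> t"
  shows "hblock s t (cosh x) (sinh x) \<in> lorentz_plus s"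
    and "hblock s t (- cosh x) (- sinh x) \<in> lorentz_plus s"
proof -
  show "hblock s t (cosh x) (sinh x) \<in> lorentz_plus s"
    using hblock_cosh_sinh_in_lorentz_plus_C[OF assms, of "of_real x"]
    by (simp add: cmat_in_lorentz_plus_C_iff[symmetric] cmat_hblock
          cosh_complex_of_real sinh_complex_of_real)
  show "hblock s t (- cosh x) (- sinh x) \<in> lorentz_plus s"
    using hblock_cosh_sinh_in_lorentz_plus_C[OF assms, of "\<i> * of_real pi + of_real x"]
    by (simp add: cmat_in_lorentz_plus_C_iff[symmetric] cmat_hblock
          cosh_i_pi_add sinh_i_pi_add cosh_complex_of_real sinh_complex_of_real)
qed

lemma lorentz_plus_mult:
  assumes "g \<in> lorentz_plus t0" "h \<in> lorentz_plus t0"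
  shows "g ** h \<in> lorentz_plus t0"
  using assms lorentz_plus_C_mult[of "cmat g" t0 "cmat h"]
  by (simp flip: cmat_in_lorentz_plus_C_iff add: cmat_mult)

text \<open>By the time-time entry of the isometry equation, column \<open>s\<close> is a unit
  time-like vector, so its time component dominates each spatial one.\<close>

lemma lorentz_plus_column_less:
  fixes s t :: "'n::finite"
  assumes h: "h \<in> lorentz_plus s" and "s \<noteq> t"
  shows "\<bar>h $ t $ s\<bar> < \<bar>h $ s $ s\<bar>"
proof -
  let ?e = "cmat (minkowski s)"
  have "transpose (cmat h) ** (?e ** cmat h) = ?e"
    using h by (simp add: cmat_in_lorentz_plus_C_iff[symmetric] lorentz_plus_C_def matrix_mul_assoc)
  then have "(transpose (cmat h) ** (?e ** cmat h)) $ s $ s = ?e $ s $ s"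
    by simp
  then have "(\<Sum>k\<in>UNIV. cmat h $ k $ s * (?e ** cmat h) $ k $ s) = - 1"
    unfolding matrix_matrix_mult_def[of "transpose (cmat h)"]
    by (simp add: transpose_def minkowski_def[of s, THEN arg_cong, of "\<lambda>M. M $ s $ s"])
  then have "complex_of_real (\<Sum>k\<in>UNIV. h $ k $ s * (if k = s then - h $ k $ s else h $ k $ s))
      = complex_of_real (- 1)"
    unfolding minkowski_mult_nth by (simp add: if_distrib cong: if_cong)
  then have eq: "(\<Sum>k\<in>UNIV. h $ k $ s * (if k = s then - h $ k $ s else h $ k $ s)) = - 1"
    using of_real_eq_iff by blast
  have split: "sum f UNIV = f s + (f t + sum f (UNIV - {s, t}))" for f :: "'n \<Rightarrow> real"
  proof -
    have "UNIV - {s} - {t} = UNIV - {s, t}" by auto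
    then show ?thesis
      using \<open>s \<noteq> t\<close> sum.remove[of UNIV s f] sum.remove[of "UNIV - {s}" t f] by simp
  qed
  have "(\<Sum>k\<in>UNIV. h $ k $ s * (if k = s then - h $ k $ s else h $ k $ s))
      = - (h $ s $ s)\<^sup>2 + ((h $ t $ s)\<^sup>2 + (\<Sum>k\<in>UNIV - {s, t}. (h $ k $ s)\<^sup>2))"
    unfolding split using \<open>s \<noteq> t\<close> by (simp add: power2_eq_square)
  moreover have "(\<Sum>k\<in>UNIV - {s, t}. (h $ k $ s)\<^sup>2) \<ge> 0"
    by (simp add: sum_nonneg)
  ultimately have "(h $ t $ s)\<^sup>2 < (h $ s $ s)\<^sup>2"
    using eq by simp
  then show ?thesis
    by (simp add: abs_le_square_iff flip: not_le)
qed

text \<open>The new time-time entry is \<open>cosh x * h $ s $ s + sinh x * h $ t $ s\<close>. The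
  first term dominates, since \<open>cosh x\<close> exceeds the modulus of \<open>sinh x\<close> and
  column \<open>s\<close> of \<open>h\<close> is time-like.\<close>

lemma boost_mult_in_lorentz_up:
  assumes h: "h \<in> lorentz_up s" and st: "s \<noteq> t"
  shows "hblock s t (cosh x) (sinh x) ** h \<in> lorentz_up s"
proof -
  have h': "h \<in> lorentz_plus s" "h $ s $ s > 0"
    using h by (auto simp: lorentz_up_def)
  have lt: "\<bar>h $ t $ s\<bar> < h $ s $ s"
    using lorentz_plus_column_less[OF h'(1) st] h'(2) by simp
  have "\<bar>sinh x\<bar> < cosh x"
    using sinh_less_cosh_real[of x] sinh_less_cosh_real[of "- x"] by (auto simp: abs_if)
  then have "\<bar>sinh x * h $ t $ s\<bar> < cosh x * h $ s $ s"
    unfolding abs_mult using lt by (intro mult_strict_mono') auto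
  then have "(hblock s t (cosh x) (sinh x) ** h) $ s $ s > 0"
    by (simp add: hblock_mult_nth[OF st])
  then show ?thesis
    using lorentz_plus_mult[OF boost_in_lorentz_plus(1)[OF st] h'(1)]
    by (simp add: lorentz_up_def)
qed

lemma boost_in_lorentz_down:
  assumes "s \<noteq> t"
  shows "hblock s t (- cosh x) (- sinh x) \<in> lorentz_down s"
  using boost_in_lorentz_plus(2)[OF assms, of x]
  by (simp add: lorentz_down_def) (simp add: hblock_def)

text \<open>The reflection negates the time-time entry; it is the negated boost at
  \<open>x = 0\<close>.\<close>

lemma reflection_mult_in_lorentz_up:
  assumes "g \<in> lorentz_down s" "s \<noteq> t"
  shows "hblock s t (- 1) 0 ** g \<in> lorentz_up s"
  using boost_in_lorentz_plus(2)[OF assms(2), of 0] assms lorentz_plus_mult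
  by (auto simp: lorentz_down_def lorentz_up_def hblock_mult_nth)

subsection \<open>Analytic continuation\<close>

definition entire_curve :: "(complex \<Rightarrow> complex^'a::finite^'b::finite) \<Rightarrow> bool" where
  "entire_curve A \<longleftrightarrow> (\<forall>i j. (\<lambda>z. A z $ i $ j) holomorphic_on UNIV)"

lemma entire_curve_mult_const:
  assumes "entire_curve A"
  shows "entire_curve (\<lambda>z. A z ** B)"
  using assms unfolding entire_curve_def matrix_matrix_mult_def
  by (auto intro!: holomorphic_intros)

lemma entire_curve_lorentz_inv:
  assumes "entire_curve A"
  shows "entire_curve (\<lambda>z. lorentz_inv t0 (A z))"
  using assms unfolding entire_curve_def lorentz_inv_nth
  by (auto intro!: holomorphic_intros)

text \<open>A general \<open>f\<close> covers both curves used later, with rapidities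
  \<open>z\<close> and \<open>\<i> * pi + z\<close>.\<close>

lemma entire_curve_boost:
  assumes "f holomorphic_on UNIV"
  shows "entire_curve (\<lambda>z. hblock s t (cosh (f z)) (sinh (f z)))"
  unfolding entire_curve_def
proof (intro allI)
  fix i j
  have "(\<lambda>z. cosh (f z)) holomorphic_on UNIV" "(\<lambda>z. sinh (f z)) holomorphic_on UNIV"
    unfolding cosh_field_def sinh_field_def using assms by (auto intro!: holomorphic_intros)
  then show "(\<lambda>z. hblock s t (cosh (f z)) (sinh (f z)) $ i $ j) holomorphic_on UNIV"
    by (cases "i = j"; cases "i = s \<or> i = t"; cases "i = s \<and> j = t \<or> i = t \<and> j = s")
       (auto simp: hblock_def)
qed

text \<open>The derivative is put into the form \<open>cscale h D\<close> so that a complex-linear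
  map can pull out \<open>h\<close> in the chain rule below.\<close>

lemma entire_curve_has_derivative:
  assumes "entire_curve A"
  obtains D where "(A has_derivative (\<lambda>h. cscale h D)) (at z)"
proof -
  define D where "D = (\<chi> i j. deriv (\<lambda>z. A z $ i $ j) z)"
  have "((\<lambda>z. A z $ i $ j) has_field_derivative D $ i $ j) (at z)" for i j
    using assms holomorphic_derivI[of _ UNIV z] by (simp add: entire_curve_def D_def)
  then have *: "((\<lambda>z. A z $ i $ j) has_derivative (\<lambda>h. cscale h D $ i $ j)) (at z)" for i j
    unfolding has_field_derivative_def
    by (rule has_derivative_eq_rhs) (simp add: cscale_def fun_eq_iff)
  have row: "((\<lambda>z. A z $ i) has_derivative (\<lambda>h. cscale h D $ i)) (at z)" for i
  proof (subst has_derivative_componentwise_within, rule ballI)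
    fix b :: "complex^'a" assume "b \<in> Basis"
    then obtain j u where b: "b = axis j u" unfolding Basis_vec_def by auto
    show "((\<lambda>z. A z $ i \<bullet> b) has_derivative (\<lambda>h. cscale h D $ i \<bullet> b)) (at z)"
      unfolding b inner_axis using * by (rule has_derivative_inner_left)
  qed
  have "(A has_derivative (\<lambda>h. cscale h D)) (at z)"
  proof (subst has_derivative_componentwise_within, rule ballI)
    fix b :: "complex^'a^'b" assume "b \<in> Basis"
    then obtain j u where b: "b = axis j u" unfolding Basis_vec_def by auto
    show "((\<lambda>z. A z \<bullet> b) has_derivative (\<lambda>h. cscale h D \<bullet> b)) (at z)"
      unfolding b inner_axis using row by (rule has_derivative_inner_left)
  qed
  then show ?thesis by (rule that)
qed

text \<open>Near each point \<open>F\<close> is the restriction of a map \<open>G\<close> on an open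
  set of matrices. The curve never leaves \<open>S\<close>, so the chain rule for \<open>G\<close>
  along \<open>A\<close> also differentiates \<open>F\<close> along \<open>A\<close>.\<close>

lemma holomorphic_on_set_entire_curve:
  assumes F: "holomorphic_on_set S F" and A: "entire_curve A" and AS: "\<And>z. A z \<in> S"
  shows "entire_curve (\<lambda>z. F (A z))"
  unfolding entire_curve_def
proof (intro allI)
  fix i j
  have "\<exists>c. ((\<lambda>z. F (A z) $ i $ j) has_field_derivative c) (at z)" for z
  proof -
    obtain U G G' where U: "open U" "A z \<in> U" and eq: "\<And>B. B \<in> U \<inter> S \<Longrightarrow> G B = F B"
      and G: "\<And>B. B \<in> U \<Longrightarrow> (G has_derivative G' B) (at B)"
      and lin: "\<And>B c X. B \<in> U \<Longrightarrow> G' B (cscale c X) = cscale c (G' B X)"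
      using F AS[of z] unfolding holomorphic_on_set_def by metis
    obtain D where D: "(A has_derivative (\<lambda>h. cscale h D)) (at z)"
      using entire_curve_has_derivative[OF A] .
    let ?E = "G' (A z) D"
    have "((\<lambda>z. G (A z)) has_derivative (\<lambda>h. G' (A z) (cscale h D))) (at z)"
      using has_derivative_compose[OF D G[OF U(2)]] .
    \<comment> \<open>Complex linearity of \<open>G'\<close> turns the real derivative into a
      complex one.\<close>
    then have "((\<lambda>z. G (A z)) has_derivative (\<lambda>h. cscale h ?E)) (at z)"
      by (simp add: lin[OF U(2)])
    then have "((\<lambda>z. G (A z) $ i $ j) has_derivative (\<lambda>h. cscale h ?E $ i $ j)) (at z)"
      by (intro bounded_linear.has_derivative[OF bounded_linear_vec_nth])
    then have d: "((\<lambda>z. G (A z) $ i $ j) has_field_derivative (?E $ i $ j)) (at z)"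
      unfolding has_field_derivative_def
      by (rule has_derivative_eq_rhs) (simp add: cscale_def fun_eq_iff)
    \<comment> \<open>Continuity makes the preimage of \<open>U\<close> an open neighbourhood of
      \<open>z\<close> on which \<open>G\<close> and \<open>F\<close> agree along the curve.\<close>
    have "continuous_on UNIV A"
      using entire_curve_has_derivative[OF A]
      by (metis continuous_at_imp_continuous_on has_derivative_continuous)
    then have "open (A -` U)"
      using U(1) by (simp add: continuous_on_open_vimage)
    then have "((\<lambda>z. F (A z) $ i $ j) has_field_derivative (?E $ i $ j)) (at z)"
      using U(2) eq AS
      by (intro has_field_derivative_transform_within_open[OF d, of "A -` U"]) auto
    then show ?thesis by blast
  qed
  then show "(\<lambda>z. F (A z) $ i $ j) holomorphic_on UNIV"
    by (simp add: holomorphic_on_open)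
qed

text \<open>Identity theorem: the zeros on the real axis accumulate at 0.\<close>

lemma entire_eq_0_if_real_0:
  assumes "f holomorphic_on UNIV" "\<And>x::real. f (of_real x) = 0"
  shows "f z = 0"
proof -
  have "(0::complex) islimpt \<real>"
  proof (rule islimptI)
    fix T :: "complex set" assume "0 \<in> T" "open T"
    then obtain e where e: "e > 0" "ball 0 e \<subseteq> T"
      using openE by blast
    then have "of_real (e/2) \<in> T" by (auto intro!: subsetD[OF e(2)])
    then show "\<exists>y\<in>\<real>. y \<in> T \<and> y \<noteq> 0"
      using e(1) by (intro bexI[of _ "of_real (e/2)"]) auto
  qed
  moreover have "f w = 0" if "w \<in> \<real>" for w
    using that assms(2) by (auto elim: Reals_cases)
  ultimately show ?thesis
    using analytic_continuation[OF assms(1), of \<real> 0 z] by auto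
qed

text \<open>A linear functional vanishing on the direction space of the affine set, composed with the
  curve, is an entire function that vanishes on the real axis.\<close>

lemma entire_curve_in_affine:
  fixes q :: "complex \<Rightarrow> 'm \<Rightarrow> complex"
  assumes aff: "\<And>x y t. x \<in> D \<Longrightarrow> y \<in> D \<Longrightarrow> (\<lambda>m. (1 - t) * x m + t * y m) \<in> D"
    and A: "finite A" and supp: "\<And>z m. q z m \<noteq> 0 \<Longrightarrow> m \<in> A"
    and hol: "\<And>m. (\<lambda>z. q z m) holomorphic_on UNIV"
    and real: "\<And>x::real. q (of_real x) \<in> D"
  shows "q z \<in> D"
proof (rule ccontr)
  assume notin: "q z \<notin> D"
  let ?s = "\<lambda>(c::complex) (f::'m \<Rightarrow> complex) m. c * f m"
  interpret V: vector_space ?s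
    by standard (auto simp: fun_eq_iff algebra_simps)
  interpret W: vector_space "(*) :: complex \<Rightarrow> complex \<Rightarrow> complex"
    by standard (auto simp: algebra_simps)
  interpret VW: vector_space_pair ?s "(*)" ..
  have q0: "q 0 \<in> D" using real[of 0] by simp
  \<comment> \<open>The direction space of \<open>D\<close>, based at \<open>q 0\<close>.\<close>
  define E where "E = {f. f + q 0 \<in> D}"
  have scale: "?s c f \<in> E" if "f \<in> E" for c f
    using aff[OF q0, of "f + q 0" c] that by (simp add: E_def plus_fun_def algebra_simps)
  have "V.subspace E"
  proof (rule V.subspaceI)
    show "0 \<in> E" using q0 by (simp add: E_def)
    fix f g assume fg: "f \<in> E" "g \<in> E"
    \<comment> \<open>Affine closure combines only two points at a time, so the sum is obtained as
      twice the midpoint.\<close>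
    have "(\<lambda>m. (1 - 1/2) * (f + q 0) m + 1/2 * (g + q 0) m) = ?s (1/2) (f + g) + q 0"
      by (simp add: fun_eq_iff field_simps)
    then have "?s (1/2) (f + g) \<in> E"
      using aff[of "f + q 0" "g + q 0" "1/2"] fg by (simp add: E_def)
    then have "?s 2 (?s (1/2) (f + g)) \<in> E" by (rule scale)
    also have "?s 2 (?s (1/2) (f + g)) = f + g" by (simp add: fun_eq_iff)
    finally show "f + g \<in> E" .
  qed (rule scale)
  define v where "v = q z - q 0"
  have "v \<notin> E" using notin by (simp add: E_def v_def)
  obtain B where B: "B \<subseteq> E" "V.independent B" "E \<subseteq> V.span B"
    using V.maximal_independent_subset[of E] by blast
  have "V.span B \<subseteq> E"
    using B(1) \<open>V.subspace E\<close> by (rule V.span_minimal)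
  \<comment> \<open>Adjoining \<open>v\<close> to a basis of \<open>E\<close> yields a functional
    that vanishes on \<open>E\<close> but is 1 at \<open>v\<close>.\<close>
  then have "V.independent (insert v B)"
    using \<open>v \<notin> E\<close> B(2) by (intro V.independent_insertI) auto
  then obtain g where g: "Vector_Spaces.linear ?s (*) g"
      "\<And>u. u \<in> insert v B \<Longrightarrow> g u = (if u = v then 1 else 0)"
    using VW.linear_independent_extend[of "insert v B" "\<lambda>u. if u = v then 1 else 0"] by metis
  interpret g: Vector_Spaces.linear ?s "(*)" g by fact
  have "g u = 0" if "u \<in> B" for u
    using g(2)[of u] that B(1) \<open>v \<notin> E\<close> by auto
  then have gE: "g u = 0" if "u \<in> E" for u
    using VW.linear_eq_0_on_span[OF g(1), of B u] that B(3) by blast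
  \<comment> \<open>The functional is purely algebraic; the common finite support \<open>A\<close>
    makes its value along the curve a finite combination of holomorphic coefficients.\<close>
  have gq: "g (q w) = (\<Sum>a\<in>A. q w a * g (\<lambda>m. if m = a then 1 else 0))" for w
  proof -
    have "q w = (\<Sum>a\<in>A. ?s (q w a) (\<lambda>m. if m = a then 1 else 0))"
    proof
      fix m
      have "(\<Sum>a\<in>A. ?s (q w a) (\<lambda>m. if m = a then 1 else 0)) m
          = (\<Sum>a\<in>A. if m = a then q w a else 0)"
        by (induction A rule: infinite_finite_induct) auto
      also have "\<dots> = q w m"
        using A supp by auto
      finally show "q w m = (\<Sum>a\<in>A. ?s (q w a) (\<lambda>m. if m = a then 1 else 0)) m" ..
    qed
    then have "g (q w) = g (\<Sum>a\<in>A. ?s (q w a) (\<lambda>m. if m = a then 1 else 0))"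
      by simp
    also have "\<dots> = (\<Sum>a\<in>A. q w a * g (\<lambda>m. if m = a then 1 else 0))"
      by (simp add: g.sum g.scale)
    finally show ?thesis .
  qed
  have "g (q z) - g (q 0) = 0"
  proof (rule entire_eq_0_if_real_0[of "\<lambda>w. g (q w) - g (q 0)"])
    show "(\<lambda>w. g (q w) - g (q 0)) holomorphic_on UNIV"
      unfolding gq by (intro holomorphic_intros hol)
    fix x :: real
    show "g (q (of_real x)) - g (q 0) = 0"
      using gE[of "q (of_real x) - q 0"] real[of x] by (simp add: E_def g.diff)
  qed
  then show False
    using g(2)[of v] by (simp add: v_def g.diff)
qed

subsection \<open>Entire families in the free algebra\<close>

text \<open>The finite support is uniform in \<open>z\<close>, so every coefficient sum runs over a
  fixed finite set.\<close>

definition entire_kel :: "(complex \<Rightarrow> ('k,'n) kel) \<Rightarrow> bool" where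
  "entire_kel F \<longleftrightarrow> (\<exists>A. finite A \<and> (\<forall>z w. F z w \<noteq> 0 \<longrightarrow> w \<in> A)) \<and>
     (\<forall>w. (\<lambda>z. F z w) holomorphic_on UNIV)"

lemma entire_kelI:
  assumes "finite A" "\<And>z w. F z w \<noteq> 0 \<Longrightarrow> w \<in> A" "\<And>w. (\<lambda>z. F z w) holomorphic_on UNIV"
  shows "entire_kel F"
  using assms unfolding entire_kel_def by blast

lemma entire_kelE:
  assumes "entire_kel F"
  obtains A where "finite A" "\<And>z w. F z w \<noteq> 0 \<Longrightarrow> w \<in> A" "\<And>w. (\<lambda>z. F z w) holomorphic_on UNIV"
  using assms unfolding entire_kel_def by blast

lemma entire_kel_const: "entire_kel (\<lambda>_. p) \<longleftrightarrow> p \<in> kset"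
  by (auto simp: entire_kel_def kset_def intro: finite_subset)

lemma entire_kel_in_kset: "entire_kel F \<Longrightarrow> F z \<in> kset"
  unfolding entire_kel_def kset_def by (auto intro: finite_subset)

lemma entire_kel_kmult:
  assumes "entire_kel F" "entire_kel G"
  shows "entire_kel (\<lambda>z. kmult (F z) (G z))"
proof -
  obtain A where A: "finite A" "\<And>z w. F z w \<noteq> 0 \<Longrightarrow> w \<in> A" "\<And>w. (\<lambda>z. F z w) holomorphic_on UNIV"
    using assms(1) by (rule entire_kelE) blast
  obtain B where B: "finite B" "\<And>z w. G z w \<noteq> 0 \<Longrightarrow> w \<in> B" "\<And>w. (\<lambda>z. G z w) holomorphic_on UNIV"
    using assms(2) by (rule entire_kelE) blast
  show ?thesis
  proof (rule entire_kelI)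
    show "finite ((\<lambda>(u, v). u @ v) ` (A \<times> B))"
      using A(1) B(1) by simp
    fix z w assume "kmult (F z) (G z) w \<noteq> 0"
    then obtain i where "F z (take i w) * G z (drop i w) \<noteq> 0"
      unfolding kmult_def by (meson sum.not_neutral_contains_not_neutral)
    then have "(take i w, drop i w) \<in> A \<times> B"
      using A(2) B(2) by auto
    then show "w \<in> (\<lambda>(u, v). u @ v) ` (A \<times> B)"
      by (intro image_eqI[of _ _ "(take i w, drop i w)"]) simp_all
  next
    show "(\<lambda>z. kmult (F z) (G z) w) holomorphic_on UNIV" for w
      unfolding kmult_def by (intro holomorphic_intros A(3) B(3))
  qed
qed

lemma entire_kel_word_img:
  assumes "\<And>x. entire_kel (\<lambda>z. f z x)"
  shows "entire_kel (\<lambda>z. word_img (f z) w)"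
proof (induction w)
  case Nil
  have "finite {w. kone w \<noteq> 0}"
    by (rule finite_subset[of _ "{[]}"]) (auto simp: kone_def)
  then show ?case
    by (simp add: word_img_def entire_kel_const kset_def)
next
  case (Cons x w)
  then show ?case
    using entire_kel_kmult[OF assms] by (simp add: word_img_def)
qed

text \<open>Replaces the support of \<open>p\<close>, which varies along a family, by a fixed index
  set.\<close>

lemma ext_lin_superset:
  assumes "finite A" "\<And>w. p w \<noteq> 0 \<Longrightarrow> w \<in> A"
  shows "ext_lin f p v = (\<Sum>w\<in>A. p w * word_img f w v)"
  unfolding ext_lin_def by (rule sum.mono_neutral_left) (use assms in auto)

lemma entire_kel_ext_lin:
  assumes f: "\<And>x. entire_kel (\<lambda>z. f z x)" and F: "entire_kel F"
  shows "entire_kel (\<lambda>z. ext_lin (f z) (F z))"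
proof -
  obtain A where A: "finite A" "\<And>z w. F z w \<noteq> 0 \<Longrightarrow> w \<in> A" "\<And>w. (\<lambda>z. F z w) holomorphic_on UNIV"
    using F by (rule entire_kelE) blast
  have eq: "ext_lin (f z) (F z) v = (\<Sum>w\<in>A. F z w * word_img (f z) w v)" for z v
    using A by (intro ext_lin_superset)
  have "\<exists>B. finite B \<and> (\<forall>z v. word_img (f z) w v \<noteq> 0 \<longrightarrow> v \<in> B)" for w
    using entire_kel_word_img[where w = w, OF f] by (simp add: entire_kel_def)
  then obtain B where B: "\<And>w. finite (B w)" "\<And>w z v. word_img (f z) w v \<noteq> 0 \<Longrightarrow> v \<in> B w"
    by metis
  show ?thesis
  proof (rule entire_kelI)
    show "finite (\<Union>w\<in>A. B w)"
      using A(1) B(1) by simp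
    fix z v assume "ext_lin (f z) (F z) v \<noteq> 0"
    then obtain w where "w \<in> A" "F z w * word_img (f z) w v \<noteq> 0"
      unfolding eq by (meson sum.not_neutral_contains_not_neutral)
    then show "v \<in> (\<Union>w\<in>A. B w)"
      using B(2) by auto
  next
    have "(\<lambda>z. word_img (f z) w v) holomorphic_on UNIV" for w v
      using entire_kel_word_img[where w = w, OF f] by (simp add: entire_kel_def)
    then show "(\<lambda>z. ext_lin (f z) (F z) v) holomorphic_on UNIV" for v
      unfolding eq by (intro holomorphic_intros A(3))
  qed
qed

lemma ext_anti_eq_ext_lin: "ext_anti f p = ext_lin f (\<lambda>w. cnj (p w))"
  by (simp add: ext_anti_def ext_lin_def)

text \<open>Conjugating argument and value together preserves holomorphy.\<close>

lemma entire_kel_cnj: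
  assumes "entire_kel F"
  shows "entire_kel (\<lambda>z w. cnj (F (cnj z) w))"
proof -
  have "range cnj = UNIV"
    by (rule surjI[of _ cnj]) simp
  then have "(\<lambda>z. cnj (F (cnj z) w)) holomorphic_on UNIV" for w
    using assms holomorphic_on_compose_cnj_cnj[of "\<lambda>z. F z w" UNIV]
    by (simp add: entire_kel_def o_def)
  then show ?thesis
    using assms by (auto simp: entire_kel_def)
qed

lemma entire_kel_gen_act:
  assumes "entire_curve R" "entire_curve Om"
  shows "entire_kel (\<lambda>z. gen_act (R z) (Om z) x)"
proof -
  obtain a l where x: "x = (a, l)" by force
  show ?thesis
  proof (rule entire_kelI)
    have "finite {js :: 'b list. length js = length l}"
      using finite_lists_length_eq[of "UNIV :: 'b set" "length l"] by simp
    then show "finite ((\<lambda>y. [y]) ` ((UNIV :: 'a set) \<times> {js :: 'b list. length js = length l}))"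
      by simp
  next
    fix z w assume "gen_act (R z) (Om z) x w \<noteq> 0"
    then show "w \<in> (\<lambda>y. [y]) ` ((UNIV :: 'a set) \<times> {js :: 'b list. length js = length l})"
      by (auto simp: x gen_act_def split: list.splits prod.splits if_splits)
  next
    fix w
    have "gen_act (R z) (Om z) x w = 0" if "\<And>y. w \<noteq> [y]" for z
      using that by (auto simp: gen_act_def split: list.splits prod.splits)
    moreover have "gen_act (R z) (Om z) x [(b, js)] = 0" if "length js \<noteq> length l" for z b js
      using that by (simp add: x gen_act_def)
    \<comment> \<open>Each coefficient is either identically zero or a polynomial in the entries of
      \<open>R z\<close> and \<open>Om z\<close>.\<close>
    ultimately consider b js where "w = [(b, js)]" "length js = length l"
      | "\<forall>z. gen_act (R z) (Om z) x w = 0"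
      by (metis surj_pair)
    then show "(\<lambda>z. gen_act (R z) (Om z) x w) holomorphic_on UNIV"
    proof cases
      case 1
      then show ?thesis
        using assms unfolding entire_curve_def
        by (auto simp: x gen_act_def intro!: holomorphic_intros)
    qed simp
  qed
qed

lemma gen_C_in_kset: "gen_C d x \<in> kset"
proof -
  have "{w. gen_C d x w \<noteq> 0} \<subseteq> (\<lambda>b. [(b, snd x)]) ` UNIV"
  proof
    fix w assume "w \<in> {w. gen_C d x w \<noteq> 0}"
    moreover have "gen_C d x w = 0" if "\<And>y. w \<noteq> [y]"
      using that by (auto simp: gen_C_def split: list.splits prod.splits)
    ultimately obtain b js where "w = [(b, js)]" "gen_C d x w \<noteq> 0" by auto
    then show "w \<in> (\<lambda>b. [(b, snd x)]) ` UNIV"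
      by (auto simp: gen_C_def split: prod.splits if_splits)
  qed
  then show ?thesis
    by (simp add: kset_def finite_subset)
qed

text \<open>An anti-linear map conjugates coefficients, so the parameter is conjugated too. Real
  parameters are unaffected.\<close>

lemma entire_kel_C_dol:
  assumes "entire_kel F"
  shows "entire_kel (\<lambda>z. C_dol d (F (if complex_lin d then z else cnj z)))"
proof (cases "complex_lin d")
  case True
  then show ?thesis
    using entire_kel_ext_lin[of "\<lambda>_. gen_C d", OF _ assms]
    by (simp add: C_dol_def entire_kel_const gen_C_in_kset)
next
  case False
  then show ?thesis
    using entire_kel_ext_lin[of "\<lambda>_. gen_C d", OF _ entire_kel_cnj[OF assms]]
    by (simp add: C_dol_def entire_kel_const gen_C_in_kset ext_anti_eq_ext_lin)
qed

section \<open>The identity matrix acts trivially\<close>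

lemma kmult_single:
  "kmult (\<lambda>w. if w = [x] then 1 else 0) (\<lambda>w. if w = u then 1 else 0) v = (if v = x # u then 1 else 0)"
proof (cases v)
  case Nil
  then show ?thesis by (simp add: kmult_def)
next
  case (Cons y t)
  \<comment> \<open>Only the split after the first letter can contribute.\<close>
  have "kmult (\<lambda>w. if w = [x] then 1 else 0) (\<lambda>w. if w = u then 1 else 0) v
      = (\<Sum>i\<le>length v. if i = 1 then if v = x # u then 1 else 0 else 0)"
    unfolding kmult_def by (rule sum.cong) (auto simp: Cons take_Cons' split: if_splits)
  then show ?thesis
    by (simp add: Cons Suc_le_eq)
qed

lemma gen_act_mat_1: "gen_act (mat 1) (mat 1) x = (\<lambda>w. if w = [x] then 1 else 0)"
proof
  fix w
  obtain a l where x: "x = (a, l)" by force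
  have "(\<Prod>m<length l. (mat 1 :: complex^'b^'b) $ (js ! m) $ (l ! m)) = (if js = l then 1 else 0)"
    if "length js = length l" for js
  proof (cases "js = l")
    case False
    then obtain m where "m < length l" "js ! m \<noteq> l ! m"
      using \<open>length js = length l\<close> nth_equalityI by metis
    then show ?thesis
      using False by (auto simp: mat_def intro!: prod_zero)
  qed (simp add: mat_def)
  then show "gen_act (mat 1) (mat 1) x w = (if w = [x] then 1 else 0)"
    by (auto simp: x gen_act_def mat_def[of 1, THEN arg_cong, of "\<lambda>M. M $ _ $ _"] split: list.splits)
qed

lemma ext_lin_gen_act_mat_1:
  assumes "p \<in> kset"
  shows "ext_lin (gen_act (mat 1) (mat 1)) p = p"
proof
  fix v
  have "word_img (gen_act (mat 1) (mat 1)) w = (\<lambda>v. if v = w then 1 else 0)"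
    for w :: "('a \<times> 'b list) list"
  proof (induction w)
    case Nil
    then show ?case by (simp add: word_img_def kone_def fun_eq_iff)
  next
    case (Cons x w)
    have "word_img (gen_act (mat 1) (mat 1)) (x # w)
        = kmult (gen_act (mat 1) (mat 1) x) (word_img (gen_act (mat 1) (mat 1)) w)"
      by (simp add: word_img_def)
    also have "\<dots> = (\<lambda>v. if v = x # w then 1 else 0)"
      unfolding Cons.IH gen_act_mat_1[of x] by (simp add: kmult_single fun_eq_iff)
    finally show ?case .
  qed
  then have "ext_lin (gen_act (mat 1) (mat 1)) p v = (\<Sum>w\<in>{w. p w \<noteq> 0}. if v = w then p w else 0)"
    by (simp add: ext_lin_def if_distrib cong: if_cong)
  \<comment> \<open>Finite support matters here: a sum over an infinite set would default to
    0.\<close>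
  also have "\<dots> = p v"
    using assms by (simp add: kset_def)
  finally show "ext_lin (gen_act (mat 1) (mat 1)) p v = p v" .
qed

text \<open>Passing to multisets sums finitely many entire coefficients, so continuation in the
  affine set \<open>Dc\<close> applies to the image under \<open>comm\<close>.\<close>

lemma entire_kel_in_comm_fft:
  assumes "comm_affine Dc" and F: "entire_kel F"
    and real: "\<And>x::real. F (of_real x) \<in> comm_fft Dc"
  shows "F z \<in> comm_fft Dc"
proof -
  obtain A where A: "finite A" "\<And>z w. F z w \<noteq> 0 \<Longrightarrow> w \<in> A" "\<And>w. (\<lambda>z. F z w) holomorphic_on UNIV"
    using F by (rule entire_kelE) blast
  have eq: "comm (F z) m = (\<Sum>w | w \<in> A \<and> mset w = m. F z w)" for z m
    unfolding comm_def by (rule sum.mono_neutral_left) (use A in auto)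
  have "comm (F z) \<in> Dc"
  proof (rule entire_curve_in_affine[of Dc "mset ` A"])
    show "finite (mset ` A)" using A(1) by simp
    show "m \<in> mset ` A" if "comm (F z) m \<noteq> 0" for z m
      using that unfolding eq by (force dest: sum.not_neutral_contains_not_neutral)
    show "(\<lambda>z. comm (F z) m) holomorphic_on UNIV" for m
      unfolding eq by (intro holomorphic_intros A(3))
    show "comm (F (of_real x)) \<in> Dc" for x
      using real[of x] by (simp add: comm_fft_def)
  qed (use assms(1) in \<open>auto simp: comm_affine_def\<close>)
  then show ?thesis
    using entire_kel_in_kset[OF F] by (simp add: comm_fft_def)
qed

text \<open>Reversal permutes the words with a given multiset of letters, so \<open>comm\<close>
  does not see it.\<close>

lemma S_rev_in_comm_fft_iff: "S_rev p \<in> comm_fft Dc \<longleftrightarrow> p \<in> comm_fft Dc"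
proof -
  have "{w. S_rev p w \<noteq> 0} = rev ` {w. p w \<noteq> 0}"
    by (force simp: S_rev_def image_iff intro: exI[of _ "rev _"])
  then have "S_rev p \<in> kset \<longleftrightarrow> p \<in> kset"
    by (simp add: kset_def finite_image_iff inj_on_def)
  moreover have "comm (S_rev p) = comm p"
    unfolding comm_def S_rev_def
    by (intro ext sum.reindex_bij_witness[of _ rev rev]) auto
  ultimately show ?thesis
    by (simp add: comm_fft_def)
qed

subsection \<open>The two continuations\<close>

text \<open>A common continuation of \<open>sigma_cl\<close> and \<open>sigma'\<close> to complex
  matrices.\<close>

definition lorentz_action :: "'n::finite \<Rightarrow> (complex^'n^'n \<Rightarrow> complex^'k::finite^'k) \<Rightarrow>
    (complex^'n^'n \<Rightarrow> complex^'n^'n) \<Rightarrow> complex^'n^'n \<Rightarrow> ('k,'n) kel \<Rightarrow> ('k,'n) kel" where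
  "lorentz_action t0 \<rho>C \<omega>C A = ext_lin (gen_act (\<rho>C (lorentz_inv t0 A)) (\<omega>C A))"

lemma sigma'_eq_lorentz_action:
  "g \<in> lorentz_plus t0 \<Longrightarrow> sigma' \<rho>C \<omega>C g = lorentz_action t0 \<rho>C \<omega>C (cmat g)"
  by (simp add: sigma'_def lorentz_action_def cmat_matrix_inv)

lemma sigma_cl_eq_lorentz_action:
  assumes "holo_ext t0 \<rho> \<rho>C" "holo_ext t0 \<omega> \<omega>C" and g: "g \<in> lorentz_up t0"
  shows "sigma_cl \<rho> \<omega> g = lorentz_action t0 \<rho>C \<omega>C (cmat g)"
proof -
  have "\<rho>C (cmat (matrix_inv g)) = cmat (\<rho> (matrix_inv g))" "\<omega>C (cmat g) = cmat (\<omega> g)"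
    using assms matrix_inv_in_lorentz_up[OF g] by (auto simp: holo_ext_def)
  moreover have "g \<in> lorentz_plus t0"
    using g by (simp add: lorentz_up_def)
  ultimately show ?thesis
    by (simp add: sigma_cl_def lorentz_action_def cmat_matrix_inv[symmetric])
qed

lemma lorentz_action_mat_1:
  assumes "holo_ext t0 \<rho> \<rho>C" "holo_ext t0 \<omega> \<omega>C" "p \<in> kset"
  shows "lorentz_action t0 \<rho>C \<omega>C (mat 1) p = p"
proof -
  have "lorentz_inv t0 (mat 1) = mat 1"
    by (auto simp: vec_eq_iff lorentz_inv_nth mat_def)
  then show ?thesis
    using assms by (simp add: lorentz_action_def holo_ext_def ext_lin_gen_act_mat_1)
qed

lemma entire_kel_lorentz_action:
  assumes "holo_ext t0 \<rho> \<rho>C" "holo_ext t0 \<omega> \<omega>C"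
    and A: "entire_curve A" "\<And>z. A z \<in> lorentz_plus_C t0" and p: "p \<in> kset"
  shows "entire_kel (\<lambda>z. lorentz_action t0 \<rho>C \<omega>C (A z) p)"
proof -
  have inv: "entire_curve (\<lambda>z. lorentz_inv t0 (A z))"
    using A(1) by (rule entire_curve_lorentz_inv)
  have \<rho>: "holomorphic_on_set (lorentz_plus_C t0) \<rho>C"
    and \<omega>: "holomorphic_on_set (lorentz_plus_C t0) \<omega>C"
    using assms(1,2) by (simp_all add: holo_ext_def)
  have "entire_curve (\<lambda>z. \<rho>C (lorentz_inv t0 (A z)))"
    using holomorphic_on_set_entire_curve[OF \<rho> inv] lorentz_inv_in_lorentz_plus_C[OF A(2)] .
  moreover have "entire_curve (\<lambda>z. \<omega>C (A z))"
    using holomorphic_on_set_entire_curve[OF \<omega> A] .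
  ultimately have "entire_kel (\<lambda>z. gen_act (\<rho>C (lorentz_inv t0 (A z))) (\<omega>C (A z)) x)" for x
    by (rule entire_kel_gen_act)
  moreover have "entire_kel (\<lambda>_. p)"
    using p by (simp add: entire_kel_const)
  ultimately show ?thesis
    unfolding lorentz_action_def by (rule entire_kel_ext_lin)
qed

text \<open>For orthochronous \<open>h\<close>, the boost of rapidity \<open>z\<close> times \<open>h\<close> runs through the orthochronous
  component for real \<open>z\<close> and reaches the other one at \<open>z = \<i>\<pi>\<close>.\<close>

lemma sigma'_lorentz_down_invariant:
  assumes \<rho>: "holo_ext t0 \<rho> \<rho>C" and \<omega>: "holo_ext t0 \<omega> \<omega>C" and "comm_affine Dc"
    and inv: "\<And>g. g \<in> lorentz_up t0 \<Longrightarrow> sigma_cl \<rho> \<omega> g ` comm_fft Dc \<subseteq> comm_fft Dc"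
    and t: "t0 \<noteq> t" and g: "g \<in> lorentz_down t0" and p: "p \<in> comm_fft Dc"
  shows "sigma' \<rho>C \<omega>C g p \<in> comm_fft Dc"
proof -
  \<comment> \<open>The reflection squares to the identity, so the curve through \<open>h\<close>
    meets \<open>g\<close> at rapidity \<open>\<i> * pi\<close>.\<close>
  define h where "h = hblock t0 t (- 1) 0 ** g"
  define A where "A z = hblock t0 t (cosh z) (sinh z) ** cmat h" for z :: complex
  let ?F = "\<lambda>z. lorentz_action t0 \<rho>C \<omega>C (A z) p"
  have h: "h \<in> lorentz_up t0"
    unfolding h_def using reflection_mult_in_lorentz_up[OF g t] .
  then have "A z \<in> lorentz_plus_C t0" for z
    unfolding A_def lorentz_up_def
    by (intro lorentz_plus_C_mult hblock_cosh_sinh_in_lorentz_plus_C[OF t])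
       (simp add: cmat_in_lorentz_plus_C_iff)
  then have F: "entire_kel ?F"
    using p unfolding A_def
    by (intro entire_kel_lorentz_action[OF \<rho> \<omega>] entire_curve_mult_const entire_curve_boost)
       (auto simp: comm_fft_def)
  have real: "?F (of_real x) \<in> comm_fft Dc" for x
  proof -
    have "A (of_real x) = cmat (hblock t0 t (cosh x) (sinh x) ** h)"
      by (simp add: A_def cmat_mult cmat_hblock cosh_complex_of_real sinh_complex_of_real)
    then show ?thesis
      using inv[OF boost_mult_in_lorentz_up[OF h t, of x]] p
      by (auto simp: sigma_cl_eq_lorentz_action[OF \<rho> \<omega> boost_mult_in_lorentz_up[OF h t]])
  qed
  have "A (\<i> * of_real pi) = cmat (hblock t0 t (- 1) 0 ** hblock t0 t (- 1) 0 ** g)"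
    using cosh_i_pi_add[of 0] sinh_i_pi_add[of 0]
    by (simp add: A_def h_def cmat_mult cmat_hblock matrix_mul_assoc)
  also have "\<dots> = cmat g"
    by (simp add: hblock_mult[OF t])
  finally show ?thesis
    using entire_kel_in_comm_fft[OF \<open>comm_affine Dc\<close> F real, of "\<i> * of_real pi"] g
    by (simp add: sigma'_eq_lorentz_action[of g t0] lorentz_down_def)
qed

text \<open>Here the curve of boosts starts in the antichronous component and reaches the identity.\<close>

lemma C_dol_invariant:
  assumes \<rho>: "holo_ext t0 \<rho> \<rho>C" and \<omega>: "holo_ext t0 \<omega> \<omega>C" and "comm_affine Dc"
    and inv: "\<And>g. g \<in> lorentz_down t0 \<Longrightarrow> (C_dol d \<circ> sigma' \<rho>C \<omega>C g) ` comm_fft Dc \<subseteq> comm_fft Dc"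
    and t: "t0 \<noteq> t" and p: "p \<in> comm_fft Dc"
  shows "C_dol d p \<in> comm_fft Dc"
proof -
  define A where "A z = hblock t0 t (cosh (\<i> * of_real pi + z)) (sinh (\<i> * of_real pi + z))"
    for z :: complex
  let ?F = "\<lambda>z. lorentz_action t0 \<rho>C \<omega>C (A z) p"
  \<comment> \<open>The conjugated parameter keeps the family entire when \<open>C_dol d\<close>
    conjugates coefficients.\<close>
  let ?c = "\<lambda>z. if complex_lin d then z else cnj z"
  have "A z \<in> lorentz_plus_C t0" for z
    unfolding A_def by (rule hblock_cosh_sinh_in_lorentz_plus_C[OF t])
  then have "entire_kel ?F"
    using p unfolding A_def
    by (intro entire_kel_lorentz_action[OF \<rho> \<omega>] entire_curve_boost holomorphic_intros)
       (auto simp: comm_fft_def)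
  then have F: "entire_kel (\<lambda>z. C_dol d (?F (?c z)))"
    by (rule entire_kel_C_dol)
  have real: "C_dol d (?F (?c (of_real x))) \<in> comm_fft Dc" for x
  proof -
    let ?g = "hblock t0 t (- cosh x) (- sinh x)"
    have "?g \<in> lorentz_down t0"
      by (rule boost_in_lorentz_down[OF t])
    moreover have "A (of_real x) = cmat ?g"
      by (simp add: A_def cmat_hblock cosh_i_pi_add sinh_i_pi_add
          cosh_complex_of_real sinh_complex_of_real)
    ultimately have "?F (of_real x) = sigma' \<rho>C \<omega>C ?g p"
      by (simp add: sigma'_eq_lorentz_action[of ?g t0] lorentz_down_def)
    then show ?thesis
      using inv[OF \<open>?g \<in> lorentz_down t0\<close>] p by auto
  qed
  have "cosh (\<i> * of_real pi) = (-1 :: complex)" "sinh (\<i> * of_real pi) = (0 :: complex)"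
    using cosh_i_pi_add[of 0] sinh_i_pi_add[of 0] by simp_all
  \<comment> \<open>The total rapidity is \<open>2 * \<i> * pi\<close> without conjugation and 0
    with it; both give the identity.\<close>
  then have "A (?c (\<i> * of_real pi)) = mat 1"
    unfolding A_def by (auto simp: cosh_i_pi_add sinh_i_pi_add)
  moreover have "p \<in> kset"
    using p by (simp add: comm_fft_def)
  ultimately show ?thesis
    using entire_kel_in_comm_fft[OF \<open>comm_affine Dc\<close> F real, of "\<i> * of_real pi"]
    by (simp only: lorentz_action_mat_1[OF \<rho> \<omega>])
qed

theorem theorem3:
  fixes t0 :: "'n::finite"
    and \<rho> :: "real^'n^'n \<Rightarrow> real^'k::finite^'k" and \<rho>C :: "complex^'n^'n \<Rightarrow> complex^'k^'k"
    and \<omega> :: "real^'n^'n \<Rightarrow> real^'n^'n" and \<omega>C :: "complex^'n^'n \<Rightarrow> complex^'n^'n"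
    and d :: "complex^'k \<Rightarrow> complex^'k"
    and Dc :: "(('k,'n) gen multiset \<Rightarrow> complex) set"
  assumes "CARD('n) \<ge> 3"
    and "is_rep t0 \<rho>" and "holo_ext t0 \<rho> \<rho>C"
    and "is_rep t0 \<omega>" and "holo_ext t0 \<omega> \<omega>C"
    and "dollar_inv d"
    and "comm_affine Dc"
    and "\<forall>g\<in>lorentz_up t0. sigma_cl \<rho> \<omega> g ` comm_fft Dc \<subseteq> comm_fft Dc"
  shows "(\<forall>g\<in>lorentz_down t0. (C_dol d \<circ> sigma' \<rho>C \<omega>C g) ` comm_fft Dc \<subseteq> comm_fft Dc)
         \<longleftrightarrow> dagger d ` comm_fft Dc \<subseteq> comm_fft Dc"
proof -
  \<comment> \<open>A second index supplies the spatial direction of the boosts.\<close>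
  have "\<exists>t. t \<noteq> t0"
  proof (rule ccontr)
    assume "\<nexists>t. t \<noteq> t0"
    then have "(UNIV :: 'n set) = {t0}" by blast
    then have "CARD('n) = card {t0}" by (rule arg_cong)
    then show False using assms(1) by simp
  qed
  then obtain t where t: "t0 \<noteq> t" by metis
  have dagger: "dagger d ` comm_fft Dc \<subseteq> comm_fft Dc \<longleftrightarrow> C_dol d ` comm_fft Dc \<subseteq> comm_fft Dc"
    by (simp add: dagger_def image_subset_iff S_rev_in_comm_fft_iff)
  show ?thesis
    unfolding dagger
  proof
    assume "\<forall>g\<in>lorentz_down t0. (C_dol d \<circ> sigma' \<rho>C \<omega>C g) ` comm_fft Dc \<subseteq> comm_fft Dc"
    then show "C_dol d ` comm_fft Dc \<subseteq> comm_fft Dc"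
      using C_dol_invariant[OF assms(3,5,7) _ t] by blast
  next
    \<comment> \<open>Here \<open>sigma'\<close> preserves the theory on its own by continuation,
      and \<open>C_dol d\<close> is applied afterwards.\<close>
    assume C: "C_dol d ` comm_fft Dc \<subseteq> comm_fft Dc"
    show "\<forall>g\<in>lorentz_down t0. (C_dol d \<circ> sigma' \<rho>C \<omega>C g) ` comm_fft Dc \<subseteq> comm_fft Dc"
      using sigma'_lorentz_down_invariant[OF assms(3,5,7) _ t] assms(8) C
      by (auto simp: image_subset_iff)
  qed
qed

end
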